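(* Let $\mathcal{M}$ be a Hadamard manifold, $\mathcal{D}\subseteq\mathcal{M}$ a nonempty open geodesically convex set, and $f:\mathcal{D}\to\mathcal{I}(\mathbb{R})$ a $gH$-directional differentiable interval valued function. If $f$ is geodesically convex on $\mathcal{D}$, then $$f'(x,\exp_x^{-1}y)\preceq f(y)-_{gH}f(x)\quad\text{for all }x,y\in\mathcal{D}.$$
   Context: $\mathcal{I}(\mathbb{R})$ is the set of closed bounded intervals $[\underline{a},\overline{a}]$ with $\underline{a}\le\overline{a}$ real. Sums and scalar multiples are Minkowski: $A+B=[\underline{a}+\underline{b},\overline{a}+\overline{b}]$, and $\lambda A=[\lambda\underline{a},\lambda\overline{a}]$ if $\lambda\ge0$, $\lambda A=[\lambda\overline{a},\lambda\underline{a}]$ if $\lambda<0$. The $gH$-difference is $A-_{gH}B=[\min\{\underline{a}-\underline{b},\overline{a}-\overline{b}\},\max\{\underline{a}-\underline{b},\overline{a}-\overline{b}\}]$. The Hausdorff metric is $d_H(A,B)=\max\{|\underline{a}-\underline{b}|,|\overline{a}-\overline{b}|\}$; limits of intervals are taken in $d_H$. Order: $A\preceq B$ iff $\underline{a}\le\underline{b}$ and $\overline{a}\le\overline{b}$. A Hadamard manifold is a simply connected complete Riemannian manifold of nonpositive sectional curvature; $\exp_x:T_x\mathcal{M}\to\mathcal{M}$ is then a diffeomorphism, and the minimal geodesic joining $x$ to $y$ is $\gamma(t)=\exp_x(t\exp_x^{-1}y)$, $t\in[0,1]$. A set $\mathcal{D}\subseteq\mathcal{M}$ is geodesically convex if it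 contains the minimal geodesic joining any two of its points. $f:\mathcal{D}\to\mathcal{I}(\mathbb{R})$ is geodesically convex on $\mathcal{D}$ if $f(\gamma(t))\preceq(1-t)f(x)+tf(y)$ for all $x,y\in\mathcal{D}$, $t\in[0,1]$, where $\gamma:[0,1]\to\mathcal{M}$ is the minimal geodesic from $x$ to $y$. $f$ has $gH$-directional derivative $f'(x,v)\in\mathcal{I}(\mathbb{R})$ at $x\in\mathcal{D}$ in direction $v\in T_x\mathcal{M}$ if the limit $f'(x,v)=\lim_{t\to0^+}\frac1t\big(f(\exp_x(tv))-_{gH}f(x)\big)$ exists; $f$ is $gH$-directional differentiable if this holds at every $x\in\mathcal{D}$ for every $v\in T_x\mathcal{M}$. *)

theory Defs
  imports "HOL-Analysis.Analysis" "HOL-Library.Interval"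
begin

section \<open>Interval arithmetic on the closed bounded real intervals\<close>

text \<open>
  \<open>\<I>(\<real>)\<close> is the type \<^typ>\<open>real interval\<close>, whose \<^term>\<open>(+)\<close> is the Minkowski sum.  The library's
  \<^term>\<open>(\<le>)\<close> on intervals is inclusion and its \<^term>\<open>(-)\<close> is the Minkowski difference;
  neither is the relation or operation used here.
\<close>

definition ivl_le :: "real interval \<Rightarrow> real interval \<Rightarrow> bool"  (infix \<open>\<preceq>\<^sub>I\<close> 50) where
  "A \<preceq>\<^sub>I B \<longleftrightarrow> lower A \<le> lower B \<and> upper A \<le> upper B"

definition ivl_scale :: "real \<Rightarrow> real interval \<Rightarrow> real interval"  (infixr \<open>\<cdot>\<^sub>I\<close> 75) where
  "l \<cdot>\<^sub>I A = (if 0 \<le> l then Interval (l * lower A, l * upper A)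
                     else Interval (l * upper A, l * lower A))"

definition gH_diff :: "real interval \<Rightarrow> real interval \<Rightarrow> real interval"  (infixl \<open>-\<^sub>g\<^sub>H\<close> 65) where
  "A -\<^sub>g\<^sub>H B =
     Interval (min (lower A - lower B) (upper A - upper B), max (lower A - lower B) (upper A - upper B))"

definition ivl_dist :: "real interval \<Rightarrow> real interval \<Rightarrow> real" where
  "ivl_dist A B = max \<bar>lower A - lower B\<bar> \<bar>upper A - upper B\<bar>"

definition ivl_tendsto :: "('a \<Rightarrow> real interval) \<Rightarrow> real interval \<Rightarrow> 'a filter \<Rightarrow> bool" where
  "ivl_tendsto F L net \<longleftrightarrow> ((\<lambda>t. ivl_dist (F t) L) \<longlongrightarrow> 0) net"


section \<open>Smooth manifolds\<close>

text \<open>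
  \<open>C\<^sup>k\<close> on an open set of a finite-dimensional space: iterated directional derivatives up to
  order \<open>k\<close> exist and are continuous.
\<close>

primrec Ck_on :: "nat \<Rightarrow> 'a::real_normed_vector set \<Rightarrow> ('a \<Rightarrow> 'b::real_normed_vector) \<Rightarrow> bool" where
  "Ck_on 0 S f \<longleftrightarrow> continuous_on S f"
| "Ck_on (Suc k) S f \<longleftrightarrow>
     (\<forall>x\<in>S. f differentiable (at x)) \<and> (\<forall>v. Ck_on k S (\<lambda>x. frechet_derivative f (at x) v))"

definition smooth_on :: "'a::real_normed_vector set \<Rightarrow> ('a \<Rightarrow> 'b::real_normed_vector) \<Rightarrow> bool" where
  "smooth_on S f \<longleftrightarrow> (\<forall>k. Ck_on k S f)"

text \<open>
  A chart is a domain together with a coordinate map into the model space \<open>'e\<close>.  A tangent vector at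
  \<open>p\<close> is the family of its coordinate vectors in all charts of the atlas around \<open>p\<close>, related by the
  derivatives of the transition maps; the value at all other charts is \<open>0\<close> so that equality of
  tangent vectors is equality of functions.
\<close>

type_synonym ('m, 'e) chart = "'m set \<times> ('m \<Rightarrow> 'e)"
type_synonym ('m, 'e) tvec = "('m, 'e) chart \<Rightarrow> 'e"

abbreviation chart_dom :: "('m, 'e) chart \<Rightarrow> 'm set" where "chart_dom c \<equiv> fst c"
abbreviation coords :: "('m, 'e) chart \<Rightarrow> 'm \<Rightarrow> 'e" where "coords c \<equiv> snd c"
abbreviation chart_inv :: "('m, 'e) chart \<Rightarrow> 'e \<Rightarrow> 'm" where
  "chart_inv c \<equiv> inv_into (chart_dom c) (coords c)"

record ('m, 'e) riemannian =
  points :: "'m set"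
  atlas :: "('m, 'e) chart set"
  metric :: "'m \<Rightarrow> ('m, 'e) tvec \<Rightarrow> ('m, 'e) tvec \<Rightarrow> real"

text \<open>
  The dimension of the manifold is that of \<open>'e\<close>, which is arbitrary but finite; being merely a
  normed space, \<open>'e\<close> may also be the zero space.  The Hausdorff property and second countability
  are inherited from the type \<open>'m\<close>.
\<close>

definition smooth_manifold ::
    "('m::{t2_space,second_countable_topology}, 'e::real_normed_vector) riemannian \<Rightarrow> bool" where
  "smooth_manifold M \<longleftrightarrow>
     (\<exists>B::'e set. finite B \<and> span B = UNIV) \<and>
     (\<Union>c\<in>atlas M. chart_dom c) = points M \<and>
     (\<forall>c\<in>atlas M.
        openin (top_of_set (points M)) (chart_dom c) \<and>
        open (coords c ` chart_dom c) \<and>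
        homeomorphism (chart_dom c) (coords c ` chart_dom c) (coords c) (chart_inv c)) \<and>
     (\<forall>c\<in>atlas M. \<forall>d\<in>atlas M.
        smooth_on (coords c ` (chart_dom c \<inter> chart_dom d)) (coords d \<circ> chart_inv c))"

definition charts_at :: "('m, 'e) riemannian \<Rightarrow> 'm \<Rightarrow> ('m, 'e) chart set" where
  "charts_at M p = {c \<in> atlas M. p \<in> chart_dom c}"

definition transition_deriv ::
    "('m, 'e::real_normed_vector) chart \<Rightarrow> ('m, 'e) chart \<Rightarrow> 'm \<Rightarrow> 'e \<Rightarrow> 'e" where
  "transition_deriv c d p = frechet_derivative (coords d \<circ> chart_inv c) (at (coords c p))"

definition tangent_space :: "('m, 'e::real_normed_vector) riemannian \<Rightarrow> 'm \<Rightarrow> ('m, 'e) tvec set" where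
  "tangent_space M p =
     {v. (\<forall>c\<in>charts_at M p. \<forall>d\<in>charts_at M p. v d = transition_deriv c d p (v c)) \<and>
         (\<forall>c. c \<notin> charts_at M p \<longrightarrow> v c = 0)}"

definition tscale :: "real \<Rightarrow> ('m, 'e::real_normed_vector) tvec \<Rightarrow> ('m, 'e) tvec"  (infixr \<open>\<cdot>\<^sub>T\<close> 75) where
  "t \<cdot>\<^sub>T v = (\<lambda>c. t *\<^sub>R v c)"

definition tadd :: "('m, 'e::real_normed_vector) tvec \<Rightarrow> ('m, 'e) tvec \<Rightarrow> ('m, 'e) tvec"  (infixl \<open>+\<^sub>T\<close> 65) where
  "v +\<^sub>T w = (\<lambda>c. v c + w c)"

definition tzero :: "('m, 'e::real_normed_vector) tvec" where
  "tzero = (\<lambda>c. 0)"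

text \<open>The tangent vector at \<open>p\<close> whose coordinate vector in the chart \<open>c\<close> is \<open>u\<close>.\<close>

definition tangent_of ::
    "('m, 'e::real_normed_vector) riemannian \<Rightarrow> ('m, 'e) chart \<Rightarrow> 'm \<Rightarrow> 'e \<Rightarrow> ('m, 'e) tvec" where
  "tangent_of M c p u = (\<lambda>d. if d \<in> charts_at M p then transition_deriv c d p u else 0)"

definition velocity ::
    "('m, 'e::real_normed_vector) riemannian \<Rightarrow> (real \<Rightarrow> 'm) \<Rightarrow> real \<Rightarrow> ('m, 'e) tvec" where
  "velocity M \<gamma> t =
     (\<lambda>c. if c \<in> charts_at M (\<gamma> t) then vector_derivative (coords c \<circ> \<gamma>) (at t) else 0)"


section \<open>Riemannian metric, Levi-Civita connection and curvature\<close>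

definition metric_in_chart ::
    "('m, 'e::real_normed_vector) riemannian \<Rightarrow> ('m, 'e) chart \<Rightarrow> 'e \<Rightarrow> 'e \<Rightarrow> 'e \<Rightarrow> real" where
  "metric_in_chart M c z u w =
     (let p = chart_inv c z in metric M p (tangent_of M c p u) (tangent_of M c p w))"

definition riemannian_manifold ::
    "('m::{t2_space,second_countable_topology}, 'e::real_normed_vector) riemannian \<Rightarrow> bool" where
  "riemannian_manifold M \<longleftrightarrow>
     smooth_manifold M \<and>
     (\<forall>p\<in>points M.
        (\<forall>u\<in>tangent_space M p. \<forall>v\<in>tangent_space M p. metric M p u v = metric M p v u) \<and>
        (\<forall>u\<in>tangent_space M p. \<forall>v\<in>tangent_space M p. \<forall>w\<in>tangent_space M p.
           metric M p (u +\<^sub>T v) w = metric M p u w + metric M p v w) \<and>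
        (\<forall>t. \<forall>u\<in>tangent_space M p. \<forall>w\<in>tangent_space M p.
           metric M p (t \<cdot>\<^sub>T u) w = t * metric M p u w) \<and>
        (\<forall>u\<in>tangent_space M p. u \<noteq> tzero \<longrightarrow> 0 < metric M p u u)) \<and>
     (\<forall>c\<in>atlas M. \<forall>u w. smooth_on (coords c ` chart_dom c) (\<lambda>z. metric_in_chart M c z u w))"

text \<open>
  The Christoffel map \<open>\<Gamma>\<^sub>z(u, w)\<close> of the Levi-Civita connection in a chart, so that
  \<open>\<nabla>\<^sub>u W = DW[u] + \<Gamma>(u, W)\<close>.  It is determined by the Koszul formula
  \<open>2 g(\<Gamma>(u,w), h) = D\<^sub>u g(w,h) + D\<^sub>w g(u,h) - D\<^sub>h g(u,w)\<close> for constant coordinate fields \<open>u, w, h\<close>.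
\<close>

definition christoffel ::
    "('m, 'e::real_normed_vector) riemannian \<Rightarrow> ('m, 'e) chart \<Rightarrow> 'e \<Rightarrow> 'e \<Rightarrow> 'e \<Rightarrow> 'e" where
  "christoffel M c z u w =
     (THE k. \<forall>h. 2 * metric_in_chart M c z k h =
        frechet_derivative (\<lambda>y. metric_in_chart M c y w h) (at z) u +
        frechet_derivative (\<lambda>y. metric_in_chart M c y u h) (at z) w -
        frechet_derivative (\<lambda>y. metric_in_chart M c y u w) (at z) h)"

text \<open>
  \<open>R(u,v)w = \<nabla>\<^sub>u\<nabla>\<^sub>v w - \<nabla>\<^sub>v\<nabla>\<^sub>u w\<close> for constant coordinate fields \<open>u, v, w\<close> (whose brackets vanish).
\<close>

definition riemann_curvature ::
    "('m, 'e::real_normed_vector) riemannian \<Rightarrow> ('m, 'e) chart \<Rightarrow> 'e \<Rightarrow> 'e \<Rightarrow> 'e \<Rightarrow> 'e \<Rightarrow> 'e" where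
  "riemann_curvature M c z u v w =
     frechet_derivative (\<lambda>y. christoffel M c y v w) (at z) u
     - frechet_derivative (\<lambda>y. christoffel M c y u w) (at z) v
     + christoffel M c z u (christoffel M c z v w)
     - christoffel M c z v (christoffel M c z u w)"

definition sectional_curvature ::
    "('m, 'e::real_normed_vector) riemannian \<Rightarrow> ('m, 'e) chart \<Rightarrow> 'e \<Rightarrow> 'e \<Rightarrow> 'e \<Rightarrow> real" where
  "sectional_curvature M c z u v =
     metric_in_chart M c z (riemann_curvature M c z u v v) u /
     (metric_in_chart M c z u u * metric_in_chart M c z v v - (metric_in_chart M c z u v)\<^sup>2)"

definition nonpositive_sectional_curvature ::
    "('m, 'e::real_normed_vector) riemannian \<Rightarrow> bool" where
  "nonpositive_sectional_curvature M \<longleftrightarrow>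
     (\<forall>c\<in>atlas M. \<forall>z\<in>coords c ` chart_dom c. \<forall>u v.
        u \<noteq> v \<and> independent {u, v} \<longrightarrow> sectional_curvature M c z u v \<le> 0)"


section \<open>Geodesics, exponential map and Hadamard manifolds\<close>

text \<open>Geodesics defined on all of \<open>\<real>\<close>: \<open>x'' + \<Gamma>\<^sub>x(x', x') = 0\<close> in every chart.\<close>

definition geodesic_line ::
    "('m::topological_space, 'e::real_normed_vector) riemannian \<Rightarrow> (real \<Rightarrow> 'm) \<Rightarrow> bool" where
  "geodesic_line M \<gamma> \<longleftrightarrow>
     continuous_on UNIV \<gamma> \<and> range \<gamma> \<subseteq> points M \<and>
     (\<forall>t. \<forall>c\<in>charts_at M (\<gamma> t).
        (coords c \<circ> \<gamma>) differentiable (at t) \<and>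
        ((\<lambda>s. vector_derivative (coords c \<circ> \<gamma>) (at s)) has_vector_derivative
           - christoffel M c (coords c (\<gamma> t))
               (vector_derivative (coords c \<circ> \<gamma>) (at t))
               (vector_derivative (coords c \<circ> \<gamma>) (at t))) (at t))"

definition geodesically_complete ::
    "('m::topological_space, 'e::real_normed_vector) riemannian \<Rightarrow> bool" where
  "geodesically_complete M \<longleftrightarrow>
     (\<forall>p\<in>points M. \<forall>v\<in>tangent_space M p.
        \<exists>\<gamma>. geodesic_line M \<gamma> \<and> \<gamma> 0 = p \<and> velocity M \<gamma> 0 = v)"

definition hadamard_manifold ::
    "('m::{t2_space,second_countable_topology}, 'e::real_normed_vector) riemannian \<Rightarrow> bool" where
  "hadamard_manifold M \<longleftrightarrow>
     riemannian_manifold M \<and> simply_connected (points M) \<and>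
     geodesically_complete M \<and> nonpositive_sectional_curvature M"

definition exp_map ::
    "('m::topological_space, 'e::real_normed_vector) riemannian \<Rightarrow> 'm \<Rightarrow> ('m, 'e) tvec \<Rightarrow> 'm" where
  "exp_map M p v = (THE \<gamma>. geodesic_line M \<gamma> \<and> \<gamma> 0 = p \<and> velocity M \<gamma> 0 = v) 1"

text \<open>
  \<open>exp\<^sub>p\<^sup>-\<^sup>1 : M \<rightarrow> T\<^sub>pM\<close>.  The value \<^const>\<open>tzero\<close> outside the range of \<open>exp\<^sub>p\<close> only makes the function
  total with values in \<open>T\<^sub>pM\<close>: on a Hadamard manifold \<open>exp\<^sub>p\<close> maps \<open>T\<^sub>pM\<close> bijectively onto the
  manifold, so that case does not occur.
\<close>

definition exp_inv ::
    "('m::topological_space, 'e::real_normed_vector) riemannian \<Rightarrow> 'm \<Rightarrow> 'm \<Rightarrow> ('m, 'e) tvec" where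
  "exp_inv M p q =
     (if q \<in> exp_map M p ` tangent_space M p
      then inv_into (tangent_space M p) (exp_map M p) q else tzero)"

definition minimal_geodesic ::
    "('m::topological_space, 'e::real_normed_vector) riemannian \<Rightarrow> 'm \<Rightarrow> 'm \<Rightarrow> real \<Rightarrow> 'm" where
  "minimal_geodesic M x y t = exp_map M x (t \<cdot>\<^sub>T exp_inv M x y)"


section \<open>Geodesic convexity and gH-directional derivatives\<close>

definition geodesically_convex_set ::
    "('m::topological_space, 'e::real_normed_vector) riemannian \<Rightarrow> 'm set \<Rightarrow> bool" where
  "geodesically_convex_set M D \<longleftrightarrow>
     D \<subseteq> points M \<and> (\<forall>x\<in>D. \<forall>y\<in>D. \<forall>t\<in>{0..1}. minimal_geodesic M x y t \<in> D)"

definition geodesically_convex_on ::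
    "('m::topological_space, 'e::real_normed_vector) riemannian \<Rightarrow> 'm set \<Rightarrow> ('m \<Rightarrow> real interval) \<Rightarrow> bool" where
  "geodesically_convex_on M D f \<longleftrightarrow>
     (\<forall>x\<in>D. \<forall>y\<in>D. \<forall>t\<in>{0..1}.
        f (minimal_geodesic M x y t) \<preceq>\<^sub>I (1 - t) \<cdot>\<^sub>I f x + t \<cdot>\<^sub>I f y)"

text \<open>
  For \<open>x\<close> in an open set \<open>D\<close> the limit only involves the values of \<open>f\<close> on \<open>D\<close>.
\<close>

definition has_gH_directional_deriv ::
    "('m::topological_space, 'e::real_normed_vector) riemannian \<Rightarrow> ('m \<Rightarrow> real interval) \<Rightarrow>
     'm \<Rightarrow> ('m, 'e) tvec \<Rightarrow> real interval \<Rightarrow> bool" where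
  "has_gH_directional_deriv M f x v L \<longleftrightarrow>
     ivl_tendsto (\<lambda>t. (1 / t) \<cdot>\<^sub>I (f (exp_map M x (t \<cdot>\<^sub>T v)) -\<^sub>g\<^sub>H f x)) L (at_right 0)"

definition gH_directional_deriv ::
    "('m::topological_space, 'e::real_normed_vector) riemannian \<Rightarrow> ('m \<Rightarrow> real interval) \<Rightarrow>
     'm \<Rightarrow> ('m, 'e) tvec \<Rightarrow> real interval" where
  "gH_directional_deriv M f x v = (THE L. has_gH_directional_deriv M f x v L)"

definition gH_directional_differentiable_on ::
    "('m::topological_space, 'e::real_normed_vector) riemannian \<Rightarrow> 'm set \<Rightarrow> ('m \<Rightarrow> real interval) \<Rightarrow> bool" where
  "gH_directional_differentiable_on M D f \<longleftrightarrow>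
     (\<forall>x\<in>D. \<forall>v\<in>tangent_space M x. \<exists>L. has_gH_directional_deriv M f x v L)"

end

theory Submission
  imports Defs
begin

text \<open>
  Endpointwise, convexity along the minimal geodesic \<open>\<gamma>\<close> from \<open>x\<close> to \<open>y\<close> bounds the increment of
  \<open>f\<close> from \<open>x\<close> to \<open>\<gamma> t\<close> by \<open>t\<close> times its increment from \<open>x\<close> to \<open>y\<close>. Since \<open>min\<close> and \<open>max\<close> are
  monotone, the \<open>gH\<close>-difference quotients are bounded by \<open>f y -\<^sub>g\<^sub>H f x\<close> for every \<open>t \<in> (0, 1]\<close>,
  and the order passes to the limit \<open>t \<rightarrow> 0\<close>.
\<close>

lemma lower_Interval: "a \<le> b \<Longrightarrow> lower (Interval (a, b)) = a"
  and upper_Interval: "a \<le> b \<Longrightarrow> upper (Interval (a, b)) = b"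
  by (simp_all add: lower.rep_eq upper.rep_eq Interval_inverse)

lemma lower_ivl_scale: "0 \<le> l \<Longrightarrow> lower (l \<cdot>\<^sub>I A) = l * lower A"
  and upper_ivl_scale: "0 \<le> l \<Longrightarrow> upper (l \<cdot>\<^sub>I A) = l * upper A"
  by (simp_all add: ivl_scale_def lower_Interval upper_Interval mult_left_mono)

lemma lower_gH_diff: "lower (A -\<^sub>g\<^sub>H B) = min (lower A - lower B) (upper A - upper B)"
  and upper_gH_diff: "upper (A -\<^sub>g\<^sub>H B) = max (lower A - lower B) (upper A - upper B)"
  by (simp_all add: gH_diff_def lower_Interval upper_Interval)

text \<open>Both endpoint differences are bounded in absolute value by \<open>ivl_dist\<close>, so
  they are squeezed to zero.\<close>

lemma ivl_tendsto_lower: "ivl_tendsto F L net \<Longrightarrow> ((\<lambda>t. lower (F t)) \<longlongrightarrow> lower L) net"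
  and ivl_tendsto_upper: "ivl_tendsto F L net \<Longrightarrow> ((\<lambda>t. upper (F t)) \<longlongrightarrow> upper L) net"
proof -
  assume "ivl_tendsto F L net"
  then have lim: "((\<lambda>t. ivl_dist (F t) L) \<longlongrightarrow> 0) net"
    by (simp add: ivl_tendsto_def)
  have "((\<lambda>t. lower (F t) - lower L) \<longlongrightarrow> 0) net"
    by (rule Lim_null_comparison[OF always_eventually lim]) (simp add: ivl_dist_def)
  then show "((\<lambda>t. lower (F t)) \<longlongrightarrow> lower L) net"
    by (rule LIM_zero_cancel)
  have "((\<lambda>t. upper (F t) - upper L) \<longlongrightarrow> 0) net"
    by (rule Lim_null_comparison[OF always_eventually lim]) (simp add: ivl_dist_def)
  then show "((\<lambda>t. upper (F t)) \<longlongrightarrow> upper L) net"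
    by (rule LIM_zero_cancel)
qed

lemma ivl_tendsto_unique:
  assumes "net \<noteq> bot" "ivl_tendsto F K net" "ivl_tendsto F L net"
  shows "K = L"
  using assms by (intro interval_eqI)
    (blast intro: tendsto_unique ivl_tendsto_lower ivl_tendsto_upper)+

lemma ivl_tendsto_upperbound:
  assumes "ivl_tendsto F L net" "\<forall>\<^sub>F t in net. F t \<preceq>\<^sub>I B" "net \<noteq> bot"
  shows "L \<preceq>\<^sub>I B"
proof -
  have "lower L \<le> lower B"
    by (rule tendsto_upperbound[OF ivl_tendsto_lower[OF assms(1)] _ assms(3)])
      (use assms(2) in \<open>auto simp: ivl_le_def elim: eventually_mono\<close>)
  moreover have "upper L \<le> upper B"
    by (rule tendsto_upperbound[OF ivl_tendsto_upper[OF assms(1)] _ assms(3)])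
      (use assms(2) in \<open>auto simp: ivl_le_def elim: eventually_mono\<close>)
  ultimately show ?thesis
    by (simp add: ivl_le_def)
qed

text \<open>Limits in the Hausdorff metric are unique along the nontrivial filter
  \<open>at_right 0\<close>, so the definite description denotes any limit at hand.\<close>

lemma gH_directional_deriv_eq:
  "has_gH_directional_deriv M f x v L \<Longrightarrow> gH_directional_deriv M f x v = L"
  unfolding gH_directional_deriv_def has_gH_directional_deriv_def
  by (rule the_equality) (auto intro: ivl_tendsto_unique[OF trivial_limit_at_right_real])

text \<open>\<open>C\<close> stands for the value of \<open>f\<close> at parameter \<open>t\<close>
  on the geodesic, \<open>A\<close> and \<open>B\<close> for its values at the two ends.\<close>

lemma gH_quotient_le:
  assumes t: "0 < t" and le: "C \<preceq>\<^sub>I (1 - t) \<cdot>\<^sub>I A + t \<cdot>\<^sub>I B" and "t \<le> 1"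
  shows "(1 / t) \<cdot>\<^sub>I (C -\<^sub>g\<^sub>H A) \<preceq>\<^sub>I B -\<^sub>g\<^sub>H A"
proof -
  have "(lower C - lower A) / t \<le> lower B - lower A" "(upper C - upper A) / t \<le> upper B - upper A"
    using assms by (simp_all add: ivl_le_def lower_ivl_scale upper_ivl_scale field_simps)
  \<comment> \<open>Dividing by a positive number preserves order, so the endpoints of the scaled
    \<open>gH\<close>-difference are the \<open>min\<close> and \<open>max\<close> of the two
    quotients just bounded.\<close>
  moreover have "min a b / t = min (a / t) (b / t)" "max a b / t = max (a / t) (b / t)" for a b
    using t by (simp_all add: min_def max_def divide_le_cancel)
  ultimately show ?thesis
    using t by (auto simp: ivl_le_def lower_ivl_scale upper_ivl_scale lower_gH_diff upper_gH_diff)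
qed

text \<open>Covers the default value of \<open>exp_inv\<close>. The compatibility condition holds
  because derivatives of transition maps are linear.\<close>

lemma tzero_in_tangent_space:
  assumes "smooth_manifold M"
  shows "tzero \<in> tangent_space M p"
proof -
  have "transition_deriv c d p 0 = 0" if "c \<in> charts_at M p" "d \<in> charts_at M p" for c d
  proof -
    have "smooth_on (coords c ` (chart_dom c \<inter> chart_dom d)) (coords d \<circ> chart_inv c)"
      using assms that unfolding smooth_manifold_def charts_at_def by blast
    \<comment> \<open>Order 0 gives only continuity; order 1 gives the differentiability that makes
      \<open>frechet_derivative\<close> linear.\<close>
    then have "Ck_on (Suc 0) (coords c ` (chart_dom c \<inter> chart_dom d)) (coords d \<circ> chart_inv c)"
      unfolding smooth_on_def by blast
    then have "(coords d \<circ> chart_inv c) differentiable (at (coords c p))"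
      using that by (auto simp: charts_at_def)
    then show ?thesis
      unfolding transition_deriv_def by (intro linear_0 linear_frechet_derivative)
  qed
  then show ?thesis
    by (simp add: tangent_space_def tzero_def)
qed

text \<open>Makes the direction admissible for directional differentiability:
  \<open>inv_into\<close> selects a preimage in the tangent space, and the default is
  \<open>tzero\<close>.\<close>

lemma exp_inv_in_tangent_space:
  "smooth_manifold M \<Longrightarrow> exp_inv M x y \<in> tangent_space M x"
  by (simp add: exp_inv_def inv_into_into tzero_in_tangent_space)

theorem theorem3p3:
  fixes M :: "('m::{t2_space,second_countable_topology}, 'e::real_normed_vector) riemannian"
    and D :: "'m set"
    and f :: "'m \<Rightarrow> real interval"
  assumes "hadamard_manifold M"
    and "D \<noteq> {}"
    and "openin (top_of_set (points M)) D"
    and "geodesically_convex_set M D"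
    and "gH_directional_differentiable_on M D f"
    and "geodesically_convex_on M D f"
  shows "\<forall>x\<in>D. \<forall>y\<in>D. gH_directional_deriv M f x (exp_inv M x y) \<preceq>\<^sub>I f y -\<^sub>g\<^sub>H f x"
proof (intro ballI)
  fix x y assume xy: "x \<in> D" "y \<in> D"
  let ?v = "exp_inv M x y"
  have "smooth_manifold M"
    using assms(1) by (simp add: hadamard_manifold_def riemannian_manifold_def)
  then obtain L where L: "has_gH_directional_deriv M f x ?v L"
    using assms(5) xy exp_inv_in_tangent_space
    unfolding gH_directional_differentiable_on_def by blast
  \<comment> \<open>The point \<open>exp_map M x (t \<cdot>\<^sub>T ?v)\<close> is by definition
    \<open>minimal_geodesic M x y t\<close>, so convexity at \<open>t\<close> supplies the
    hypothesis of \<open>gH_quotient_le\<close>.\<close>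
  have "(1 / t) \<cdot>\<^sub>I (f (exp_map M x (t \<cdot>\<^sub>T ?v)) -\<^sub>g\<^sub>H f x) \<preceq>\<^sub>I f y -\<^sub>g\<^sub>H f x"
    if "0 < t" "t < 1" for t
    using assms(6) xy that
    by (intro gH_quotient_le) (auto simp: geodesically_convex_on_def minimal_geodesic_def)
  then have "\<forall>\<^sub>F t in at_right 0.
      (1 / t) \<cdot>\<^sub>I (f (exp_map M x (t \<cdot>\<^sub>T ?v)) -\<^sub>g\<^sub>H f x) \<preceq>\<^sub>I f y -\<^sub>g\<^sub>H f x"
    by (intro eventually_at_rightI[of 0 1]) auto
  then have "L \<preceq>\<^sub>I f y -\<^sub>g\<^sub>H f x"
    using L ivl_tendsto_upperbound trivial_limit_at_right_real
    unfolding has_gH_directional_deriv_def by blast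
  then show "gH_directional_deriv M f x ?v \<preceq>\<^sub>I f y -\<^sub>g\<^sub>H f x"
    using gH_directional_deriv_eq[OF L] by simp
qed

end
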